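(* Let $n \geq 1$ be an integer. The $n$-dimensional hypercube $Q_n$ has an $L_{16}$-decomposition if and only if $n = 4$ or $n \geq 6$.
   Context: For a positive integer $n$, the hypercube $Q_n$ is the graph whose vertices are the binary strings $x_1x_2\cdots x_n$ ($x_i\in\{0,1\}$), two vertices being adjacent if and only if they differ in exactly one position. For an integer $k \geq 3$, the sunlet graph $L_{2k}$ is the graph obtained from a cycle $C_k$ of length $k$ by attaching one pendant edge (to a new vertex) at each vertex of the cycle; it has $2k$ vertices and $2k$ edges. For a graph $H$, an $H$-decomposition of a graph $G$ is a collection of edge-disjoint subgraphs of $G$, each isomorphic to $H$, whose edge sets partition $E(G)$. *)

theory Defs
  imports Main
begin

record 'a ugraph =
  verts :: "'a set"
  edges :: "'a set set"

definition simple_graph :: "'a ugraph \<Rightarrow> bool" where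
  "simple_graph G \<longleftrightarrow> (\<forall>e\<in>edges G. e \<subseteq> verts G \<and> card e = 2)"

definition subgraph :: "'a ugraph \<Rightarrow> 'a ugraph \<Rightarrow> bool" where
  "subgraph S G \<longleftrightarrow> simple_graph S \<and> verts S \<subseteq> verts G \<and> edges S \<subseteq> edges G"

definition isomorphic :: "'a ugraph \<Rightarrow> 'b ugraph \<Rightarrow> bool" where
  "isomorphic G H \<longleftrightarrow> (\<exists>f. bij_betw f (verts G) (verts H) \<and>
     (\<forall>u\<in>verts G. \<forall>v\<in>verts G. {u, v} \<in> edges G \<longleftrightarrow> {f u, f v} \<in> edges H))"

definition is_decomposition :: "'b ugraph \<Rightarrow> 'a ugraph \<Rightarrow> 'a ugraph set \<Rightarrow> bool" where
  "is_decomposition H G \<D> \<longleftrightarrow>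
     (\<forall>S\<in>\<D>. subgraph S G \<and> isomorphic S H) \<and>
     (\<forall>S\<in>\<D>. \<forall>T\<in>\<D>. S \<noteq> T \<longrightarrow> edges S \<inter> edges T = {}) \<and>
     (\<Union>S\<in>\<D>. edges S) = edges G"

definition has_decomposition :: "'b ugraph \<Rightarrow> 'a ugraph \<Rightarrow> bool" where
  "has_decomposition H G \<longleftrightarrow> (\<exists>\<D>. is_decomposition H G \<D>)"

definition hypercube :: "nat \<Rightarrow> bool list ugraph" where
  "hypercube n = \<lparr>
     verts = {x. length x = n},
     edges = {{x, y} | x y. length x = n \<and> length y = n \<and> (\<exists>!i. i < n \<and> x ! i \<noteq> y ! i)}\<rparr>"

text \<open>
  \<open>sunlet k\<close> is $L_{2k}$ (for $k \ge 3$): the cycle runs through the vertices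
  \<open>(i, False)\<close>, and \<open>(i, True)\<close> is the pendant vertex attached to \<open>(i, False)\<close>.
\<close>

definition sunlet :: "nat \<Rightarrow> (nat \<times> bool) ugraph" where
  "sunlet k = \<lparr>
     verts = {..<k} \<times> UNIV,
     edges = {{(i, False), (Suc i mod k, False)} | i. i < k}
           \<union> {{(i, False), (i, True)} | i. i < k}\<rparr>"

lemma simple_graph_hypercube: "simple_graph (hypercube n)"
  by (auto simp: simple_graph_def hypercube_def card_2_iff)

lemma simple_graph_sunlet:
  assumes "k \<ge> 3"
  shows "simple_graph (sunlet k)"
proof -
  have "Suc i mod k \<noteq> i \<and> Suc i mod k < k" if "i < k" for i
    using that assms by (cases "Suc i = k") auto
  then show ?thesis
    by (fastforce simp: simple_graph_def sunlet_def card_2_iff)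
qed

end

theory Submission
  imports Defs
begin

text \<open>
  Necessity: a decomposition of $Q_n$ has $n 2^{n-1} / 16$ members, which is not an integer for
  $n \le 3$. For $n = 5$ a vertex has degree 5, so it lies on the cycle of at most one of the
  5 sunlets, but their cycles need $5 \cdot 8 > 32$ vertices.

  Sufficiency: as $Q_{m+n}$ is the Cartesian product of $Q_m$ and $Q_n$, decompositions of $Q_m$
  and $Q_n$ give one of $Q_{m+n}$, so $n = 4, 6, 7, 9$ suffice. For these, take all translates of
  a few explicit sunlets by the binary linear code with parity check matrix $H$. Every edge occurs
  exactly once if the pairs (syndrome of an end point, direction), taken over all oriented edges
  of the explicit sunlets, run through all possible pairs exactly once.
\<close>

subsection \<open>Images of graphs\<close>

text \<open>Copies of a graph are written as images under injections; the layers of a product and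
  the translates of a sunlet both arise this way.\<close>

definition image_graph :: "('a \<Rightarrow> 'b) \<Rightarrow> 'a ugraph \<Rightarrow> 'b ugraph" where
  "image_graph f G = \<lparr>verts = f ` verts G, edges = image f ` edges G\<rparr>"

lemma verts_image_graph [simp]: "verts (image_graph f G) = f ` verts G"
  and edges_image_graph [simp]: "edges (image_graph f G) = image f ` edges G"
  by (simp_all add: image_graph_def)

lemma simple_graph_image_graph:
  assumes "simple_graph G" "inj_on f (verts G)"
  shows "simple_graph (image_graph f G)"
  unfolding simple_graph_def
proof
  fix e assume "e \<in> edges (image_graph f G)"
  then obtain d where d: "d \<in> edges G" "e = f ` d" by auto
  then have "d \<subseteq> verts G" "card d = 2" using assms by (auto simp: simple_graph_def)
  then show "e \<subseteq> verts (image_graph f G) \<and> card e = 2"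
    using d card_image[OF inj_on_subset[OF assms(2)]] by auto
qed

text \<open>Compose the given isomorphism with the inverse of \<open>f\<close>. Simplicity of
  \<open>G\<close> keeps edges inside \<open>verts G\<close>, where \<open>f\<close> is injective,
  so an edge can be recovered from its image.\<close>

lemma isomorphic_image_graph:
  assumes iso: "isomorphic G H" and G: "simple_graph G" and inj: "inj_on f (verts G)"
  shows "isomorphic (image_graph f G) H"
proof -
  obtain h where h: "bij_betw h (verts G) (verts H)"
    "\<And>u v. u \<in> verts G \<Longrightarrow> v \<in> verts G \<Longrightarrow> {u, v} \<in> edges G \<longleftrightarrow> {h u, h v} \<in> edges H"
    using iso by (auto simp: isomorphic_def)
  let ?g = "inv_into (verts G) f"
  have "bij_betw ?g (f ` verts G) (verts G)"
    using inj by (simp add: bij_betw_inv_into inj_on_imp_bij_betw)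
  then have bij: "bij_betw (h \<circ> ?g) (f ` verts G) (verts H)"
    using h(1) by (rule bij_betw_trans)
  have edge: "{f u, f v} \<in> image f ` edges G \<longleftrightarrow> {u, v} \<in> edges G"
    if "u \<in> verts G" "v \<in> verts G" for u v
  proof
    assume "{f u, f v} \<in> image f ` edges G"
    then obtain d where d: "d \<in> edges G" "f ` {u, v} = f ` d" by auto
    moreover have "d \<subseteq> verts G" using d G by (auto simp: simple_graph_def)
    ultimately have "{u, v} = d" using inj that by (metis inj_on_image_eq_iff insert_subset empty_subsetI)
    then show "{u, v} \<in> edges G" using d by simp
  next
    assume "{u, v} \<in> edges G"
    then have "f ` {u, v} \<in> image f ` edges G" by (rule imageI)
    then show "{f u, f v} \<in> image f ` edges G" by simp
  qed
  show ?thesis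
    unfolding isomorphic_def
  proof (intro exI[of _ "h \<circ> ?g"] conjI ballI)
    show "bij_betw (h \<circ> ?g) (verts (image_graph f G)) (verts H)" using bij by simp
  next
    fix a b assume "a \<in> verts (image_graph f G)" "b \<in> verts (image_graph f G)"
    then obtain u v where "u \<in> verts G" "a = f u" "v \<in> verts G" "b = f v" by auto
    then show "{a, b} \<in> edges (image_graph f G) \<longleftrightarrow> {(h \<circ> ?g) a, (h \<circ> ?g) b} \<in> edges H"
      using edge h(2) inj by simp
  qed
qed

lemma isomorphic_refl: "isomorphic G G"
  unfolding isomorphic_def by (rule exI[of _ id]) auto

text \<open>The inverse of the isomorphism serves as \<open>f\<close>. Since
  \<open>isomorphic\<close> only compares pairs of vertices, simplicity of both graphs is what turns
  it into equality of edge sets. Counts in a copy can then be done in \<open>H\<close>.\<close>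

lemma isomorphic_imp_image_graph:
  assumes iso: "isomorphic G H" and G: "simple_graph G" and H: "simple_graph H"
  obtains f where "inj_on f (verts H)" "G = image_graph f H"
proof -
  obtain h where h: "bij_betw h (verts G) (verts H)"
    "\<And>u v. u \<in> verts G \<Longrightarrow> v \<in> verts G \<Longrightarrow> {u, v} \<in> edges G \<longleftrightarrow> {h u, h v} \<in> edges H"
    using iso by (auto simp: isomorphic_def)
  let ?f = "inv_into (verts G) h"
  have bij: "bij_betw ?f (verts H) (verts G)" using h(1) by (rule bij_betw_inv_into)
  have fh: "?f (h u) = u" if "u \<in> verts G" for u using h(1) that by (simp add: bij_betw_def)
  have hf: "h (?f a) = a" "?f a \<in> verts G" if "a \<in> verts H" for a
    using h(1) bij that by (auto simp: bij_betw_def f_inv_into_f)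
  have "edges G = image ?f ` edges H"
  proof (intro equalityI subsetI)
    fix e assume e: "e \<in> edges G"
    then have "e \<subseteq> verts G" "card e = 2" using G by (auto simp: simple_graph_def)
    then obtain u v where uv: "e = {u, v}" "u \<in> verts G" "v \<in> verts G" by (auto simp: card_2_iff)
    then have "{h u, h v} \<in> edges H" using h(2) e by simp
    then have "?f ` {h u, h v} \<in> image ?f ` edges H" by (rule imageI)
    then show "e \<in> image ?f ` edges H" using uv fh by simp
  next
    fix e assume "e \<in> image ?f ` edges H"
    then obtain d where d: "d \<in> edges H" "e = ?f ` d" by auto
    then have "d \<subseteq> verts H" "card d = 2" using H by (auto simp: simple_graph_def)
    then obtain a b where "d = {a, b}" "a \<in> verts H" "b \<in> verts H" by (auto simp: card_2_iff)
    then show "e \<in> edges G" using d h(2) hf by simp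
  qed
  moreover have "verts G = ?f ` verts H" using bij by (simp add: bij_betw_def)
  ultimately have "G = image_graph ?f H" by (simp add: image_graph_def)
  then show thesis using that bij by (auto simp: bij_betw_def)
qed

subsection \<open>Edges of the hypercube\<close>

definition flip :: "nat \<Rightarrow> bool list \<Rightarrow> bool list" where
  "flip i x = x[i := \<not> x ! i]"

lemma length_flip [simp]: "length (flip i x) = length x"
  by (simp add: flip_def)

lemma nth_flip: "j < length x \<Longrightarrow> flip i x ! j = (if i = j then \<not> x ! j else x ! j)"
  by (auto simp: flip_def nth_list_update)

lemma flip_flip [simp]: "flip i (flip i x) = x"
  by (rule nth_equalityI) (auto simp: nth_flip)

lemma flip_neq: "i < length x \<Longrightarrow> flip i x \<noteq> x"
  by (metis nth_flip)

lemma flip_inject: "i < length x \<Longrightarrow> j < length x \<Longrightarrow> flip i x = flip j x \<longleftrightarrow> i = j"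
  by (metis nth_flip)

text \<open>Describing an edge by an end point and a direction is two-to-one: only the end point can
  be chosen. This is why both orientations of an edge are labelled later.\<close>

lemma edge_flip_eq_iff:
  assumes "i < length x" "j < length y" "length x = length y"
  shows "{x, flip i x} = {y, flip j y} \<longleftrightarrow> i = j \<and> (x = y \<or> x = flip i y)"
proof
  assume "{x, flip i x} = {y, flip j y}"
  then consider "x = y" "flip i x = flip j y" | "x = flip j y" "flip i x = y"
    by (auto simp: doubleton_eq_iff)
  then show "i = j \<and> (x = y \<or> x = flip i y)"
  proof cases
    case 1
    then show ?thesis using assms by (simp add: flip_inject)
  next
    case 2
    then have "flip i x = flip j x" by simp
    then have "i = j" using assms by (simp add: flip_inject)
    then show ?thesis using 2 by simp
  qed
qed auto

lemma verts_hypercube [simp]: "verts (hypercube n) = {x. length x = n}"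
  by (simp add: hypercube_def)

lemma edges_hypercube: "edges (hypercube n) = {{x, flip i x} | x i. length x = n \<and> i < n}"
proof (intro equalityI subsetI)
  fix e assume "e \<in> edges (hypercube n)"
  then obtain x y where e: "e = {x, y}" "length x = n" "length y = n"
    and ex1: "\<exists>!i. i < n \<and> x ! i \<noteq> y ! i"
    by (auto simp: hypercube_def)
  from ex1 obtain i where i: "i < n" "x ! i \<noteq> y ! i" "\<forall>j. j < n \<and> x ! j \<noteq> y ! j \<longrightarrow> j = i"
    by (rule ex1E) blast
  have "y = flip i x"
  proof (rule nth_equalityI)
    fix j assume "j < length y"
    then have "j < n" using e(3) by simp
    then show "y ! j = flip i x ! j" using i(2,3) e(2) by (metis nth_flip)
  qed (simp add: e)
  then show "e \<in> {{x, flip i x} | x i. length x = n \<and> i < n}" using e i by blast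
next
  fix e assume "e \<in> {{x, flip i x} | x i. length x = n \<and> i < n}"
  then obtain x i where e: "e = {x, flip i x}" "length x = n" "i < n" by blast
  then have "\<exists>!j. j < n \<and> x ! j \<noteq> flip i x ! j"
    by (intro ex1I[of _ i]; simp add: nth_flip) (metis nth_flip)
  moreover have "length (flip i x) = n" using e by simp
  ultimately show "e \<in> edges (hypercube n)" using e(1,2)
    unfolding hypercube_def ugraph.simps mem_Collect_eq by blast
qed

lemma edges_hypercube_at:
  assumes "length x = n"
  shows "{e \<in> edges (hypercube n). x \<in> e} = (\<lambda>i. {x, flip i x}) ` {..<n}"
proof (intro equalityI subsetI)
  fix e assume "e \<in> {e \<in> edges (hypercube n). x \<in> e}"
  then obtain y i where y: "e = {y, flip i y}" "i < n" "x = y \<or> x = flip i y"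
    by (auto simp: edges_hypercube)
  then have "e = {x, flip i x}" by (auto simp: insert_commute)
  then show "e \<in> (\<lambda>i. {x, flip i x}) ` {..<n}" using y by simp
next
  fix e assume "e \<in> (\<lambda>i. {x, flip i x}) ` {..<n}"
  then show "e \<in> {e \<in> edges (hypercube n). x \<in> e}"
    using assms unfolding edges_hypercube by blast
qed

lemma degree_hypercube:
  assumes "length x = n"
  shows "card {e \<in> edges (hypercube n). x \<in> e} = n"
proof -
  have "inj_on (\<lambda>i. {x, flip i x}) {..<n}"
    using assms by (auto simp: inj_on_def edge_flip_eq_iff)
  then show ?thesis using edges_hypercube_at[OF assms] by (simp add: card_image)
qed

lemma finite_verts_hypercube: "finite {x :: bool list. length x = n}"
  and card_verts_hypercube: "card {x :: bool list. length x = n} = 2 ^ n"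
  using finite_lists_length_eq[of "UNIV :: bool set" n] card_lists_length_eq[of "UNIV :: bool set" n]
  by auto

lemma finite_edges_hypercube: "finite (edges (hypercube n))"
proof (rule finite_subset)
  show "edges (hypercube n) \<subseteq> Pow {x. length x = n}"
    using simple_graph_hypercube[of n] by (auto simp: simple_graph_def)
qed (simp add: finite_verts_hypercube)

text \<open>Double counting of incidences between vertices and edges.\<close>

lemma card_edges_hypercube: "2 * card (edges (hypercube n)) = n * 2 ^ n"
proof -
  have "card {x \<in> {x. length x = n}. x \<in> e} = 2" if "e \<in> edges (hypercube n)" for e
  proof -
    have "e \<subseteq> {x. length x = n}" "card e = 2"
      using that simple_graph_hypercube[of n] by (auto simp: simple_graph_def)
    moreover from this have "{x \<in> {x. length x = n}. x \<in> e} = e" by auto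
    ultimately show ?thesis by simp
  qed
  then have "(\<Sum>x | length x = n. card {e \<in> edges (hypercube n). x \<in> e}) = 2 * card (edges (hypercube n))"
    by (intro sum_multicount finite_verts_hypercube finite_edges_hypercube) auto
  then show ?thesis by (simp add: degree_hypercube card_verts_hypercube mult.commute)
qed

subsection \<open>Necessity\<close>

lemma card_edges_sunlet_8: "card (edges (sunlet 8)) = 16"
proof -
  \<comment> \<open>With explicit index lists the simplifier can enumerate both families and compare
    their members.\<close>
  have "edges (sunlet 8) = (\<lambda>i. {(i, False), (Suc i mod 8, False)}) ` set [0..<8]
      \<union> (\<lambda>i. {(i, False), (i, True)}) ` set [0..<8]"
    by (auto simp: sunlet_def)
  then show ?thesis by (simp add: upt_rec doubleton_eq_iff)
qed

text \<open>The pendant edge and the cycle edges to successor and predecessor meet at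
  \<open>(i, False)\<close>; \<open>k \<ge> 3\<close> makes the two neighbours on the cycle
  different.\<close>

lemma degree_sunlet:
  assumes k: "k \<ge> 3" and i: "i < k"
  shows "card {e \<in> edges (sunlet k). (i, False) \<in> e} \<ge> 3"
proof -
  \<comment> \<open>\<open>j\<close> is the predecessor of \<open>i\<close> on the cycle, which is
    \<open>k - 1\<close> when \<open>i = 0\<close>.\<close>
  obtain j where j: "j < k" "Suc j mod k = i" "j \<noteq> i" "j \<noteq> Suc i mod k"
  proof (cases i)
    case 0
    then show thesis using that[of "k - 1"] k by auto
  next
    case (Suc l)
    then show thesis using that[of l] k i by (cases "Suc i = k") auto
  qed
  let ?A = "{{(i, False), (Suc i mod k, False)}, {(j, False), (i, False)}, {(i, False), (i, True)}}"
  have "Suc i mod k \<noteq> i" using k i by (cases "Suc i = k") auto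
  then have "card ?A = 3" using j by (auto simp: card_insert_if doubleton_eq_iff)
  moreover have "?A \<subseteq> {e \<in> edges (sunlet k). (i, False) \<in> e}"
    using i j by (auto simp: sunlet_def)
  moreover have "finite (edges (sunlet k))" by (auto simp: sunlet_def)
  ultimately show ?thesis by (metis (no_types, lifting) card_mono finite_Collect_conjI finite_subset mem_Collect_eq subsetI)
qed

text \<open>The images of the cycle vertices have degree at least 3. Detecting them by degree makes
  the bound independent of the chosen isomorphism.\<close>

lemma card_branch_vertices:
  assumes "subgraph S G" "isomorphic S (sunlet k)" "k \<ge> 3" "finite (verts S)"
  shows "k \<le> card {v \<in> verts S. card {e \<in> edges S. v \<in> e} \<ge> 3}"
proof -
  obtain f where f: "inj_on f (verts (sunlet k))" "S = image_graph f (sunlet k)"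
    using assms isomorphic_imp_image_graph simple_graph_sunlet by (metis subgraph_def)
  have "f (i, False) \<in> {v \<in> verts S. card {e \<in> edges S. v \<in> e} \<ge> 3}" if i: "i < k" for i
  proof -
    have "inj_on (image f) (edges (sunlet k))"
      using f(1) simple_graph_sunlet[OF \<open>k \<ge> 3\<close>]
      by (meson inj_on_image_Pow inj_on_subset PowI simple_graph_def subsetI)
    then have "card (image f ` {e \<in> edges (sunlet k). (i, False) \<in> e})
        = card {e \<in> edges (sunlet k). (i, False) \<in> e}"
      by (intro card_image) (auto intro: inj_on_subset)
    moreover have "image f ` {e \<in> edges (sunlet k). (i, False) \<in> e} \<subseteq> {e \<in> edges S. f (i, False) \<in> e}"
      using f(2) by auto
    moreover have "finite (edges S)" using f(2) by (auto simp: sunlet_def)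
    ultimately have "card {e \<in> edges S. f (i, False) \<in> e} \<ge> 3"
      using degree_sunlet[OF \<open>k \<ge> 3\<close> i]
      by (metis (no_types, lifting) card_mono finite_Collect_conjI finite_subset mem_Collect_eq subsetI order_trans)
    moreover have "f (i, False) \<in> verts S" using f(2) i by (auto simp: sunlet_def)
    ultimately show ?thesis by simp
  qed
  then have "(\<lambda>i. f (i, False)) ` {..<k} \<subseteq> {v \<in> verts S. card {e \<in> edges S. v \<in> e} \<ge> 3}" by auto
  then have "card ((\<lambda>i. f (i, False)) ` {..<k}) \<le> card {v \<in> verts S. card {e \<in> edges S. v \<in> e} \<ge> 3}"
    using assms(4) by (intro card_mono) auto
  moreover have "inj_on (\<lambda>i. f (i, False)) {..<k}"
    using f(1) by (auto simp: inj_on_def sunlet_def)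
  ultimately show ?thesis by (simp add: card_image)
qed

lemma sunlet_8_decomposition_imp:
  assumes "n \<ge> 1" "has_decomposition (sunlet 8) (hypercube n)"
  shows "n = 4 \<or> n \<ge> 6"
proof (rule ccontr)
  assume "\<not> ?thesis"
  then have n: "n \<in> {1, 2, 3, 5}" using assms(1) by auto
  obtain D where "is_decomposition (sunlet 8) (hypercube n) D"
    using assms(2) by (auto simp: has_decomposition_def)
  then have D: "\<And>S. S \<in> D \<Longrightarrow> subgraph S (hypercube n)"
    "\<And>S. S \<in> D \<Longrightarrow> isomorphic S (sunlet 8)"
    "\<And>S T. S \<in> D \<Longrightarrow> T \<in> D \<Longrightarrow> S \<noteq> T \<Longrightarrow> edges S \<inter> edges T = {}"
    "(\<Union>S\<in>D. edges S) = edges (hypercube n)"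
    unfolding is_decomposition_def by blast+
  have fin: "finite (edges S)" "finite (verts S)" if "S \<in> D" for S
    using D(1)[OF that] finite_verts_hypercube finite_edges_hypercube
    by (auto simp: subgraph_def intro: finite_subset)
  have card: "card (edges S) = 16" if S: "S \<in> D" for S
  proof -
    obtain f where f: "inj_on f (verts (sunlet 8))" "S = image_graph f (sunlet 8)"
      using D(1,2)[OF S] isomorphic_imp_image_graph simple_graph_sunlet[of 8]
      by (auto simp: subgraph_def)
    moreover have "inj_on (image f) (edges (sunlet 8))"
      using f(1) simple_graph_sunlet[of 8]
      by (auto simp: simple_graph_def intro: inj_on_subset[OF inj_on_image_Pow])
    ultimately show ?thesis by (simp add: card_image card_edges_sunlet_8)
  qed
  \<comment> \<open>Different members with equal edge sets would have disjoint, hence empty, edge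
    sets, but each has 16 edges. This makes \<open>D\<close> finite.\<close>
  have inj: "inj_on edges D"
    using D(3) card by (fastforce simp: inj_on_def)
  have finD: "finite D"
  proof (rule finite_imageD[OF _ inj])
    have "edges ` D \<subseteq> Pow (edges (hypercube n))" using D(4) by auto
    then show "finite (edges ` D)" by (rule finite_subset) (simp add: finite_edges_hypercube)
  qed
  have "card (edges (hypercube n)) = (\<Sum>S\<in>D. card (edges S))"
    unfolding D(4)[symmetric] using D(3) fin finD by (intro card_UN_disjoint) auto
  then have count: "32 * card D = n * 2 ^ n" using card card_edges_hypercube[of n] by simp
  \<comment> \<open>For \<open>n\<close> equal to 1, 2, 3 the right side is 2, 8, 24, not a multiple
    of 32; for 5 it is 160.\<close>
  then have n5: "n = 5" "card D = 5" using n by (auto, presburger+)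
  let ?C = "\<lambda>S. {v \<in> verts S. card {e \<in> edges S. v \<in> e} \<ge> 3}"
  \<comment> \<open>A common vertex would have degree at least 3 + 3 in a graph that is regular of
    degree 5.\<close>
  have "?C S \<inter> ?C T = {}" if ST: "S \<in> D" "T \<in> D" "S \<noteq> T" for S T
  proof (rule ccontr)
    assume "?C S \<inter> ?C T \<noteq> {}"
    then obtain v where v: "v \<in> ?C S" "v \<in> ?C T" by auto
    let ?E = "\<lambda>S. {e \<in> edges S. v \<in> e}"
    have "card (?E S) + card (?E T) = card (?E S \<union> ?E T)"
      using fin ST D(3)[OF ST] by (intro card_Un_disjoint[symmetric]) auto
    also have "\<dots> \<le> card (?E (hypercube n))"
      using ST D(4) finite_edges_hypercube by (intro card_mono) auto
    also have "\<dots> = 5"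
    proof -
      have "length v = n" using v(1) D(1)[OF ST(1)] by (auto simp: subgraph_def)
      then show ?thesis using degree_hypercube[of v n] n5(1) by simp
    qed
    finally show False using v by simp
  qed
  then have "card (\<Union>S\<in>D. ?C S) = (\<Sum>S\<in>D. card (?C S))"
    using fin finD by (intro card_UN_disjoint) auto
  moreover have "(\<Sum>S\<in>D. card (?C S)) \<ge> (\<Sum>S\<in>D. 8)"
    using card_branch_vertices[OF D(1) D(2)] fin by (intro sum_mono) auto
  moreover have "card (\<Union>S\<in>D. ?C S) \<le> card {x :: bool list. length x = n}"
    using D(1) by (intro card_mono finite_verts_hypercube) (auto simp: subgraph_def)
  \<comment> \<open>Five disjoint sets of at least 8 vertices do not fit into 32 vertices.\<close>
  ultimately show False using n5 by (simp add: card_verts_hypercube)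
qed

subsection \<open>Combining decompositions\<close>

text \<open>Lets a single sunlet enter \<open>has_decomposition_UN\<close> as a piece.\<close>

lemma has_decomposition_refl: "simple_graph G \<Longrightarrow> has_decomposition G G"
  unfolding has_decomposition_def is_decomposition_def
  by (rule exI[of _ "{G}"]) (auto simp: subgraph_def isomorphic_refl)

lemma has_decomposition_image_graph:
  assumes "has_decomposition H G" "simple_graph G" and inj: "inj_on f (verts G)"
  shows "has_decomposition H (image_graph f G)"
proof -
  obtain D where "is_decomposition H G D"
    using assms(1) by (auto simp: has_decomposition_def)
  then have D: "\<And>S. S \<in> D \<Longrightarrow> subgraph S G" "\<And>S. S \<in> D \<Longrightarrow> isomorphic S H"
    "\<And>S T. S \<in> D \<Longrightarrow> T \<in> D \<Longrightarrow> S \<noteq> T \<Longrightarrow> edges S \<inter> edges T = {}"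
    "(\<Union>S\<in>D. edges S) = edges G"
    unfolding is_decomposition_def by blast+
  have injS: "inj_on f (verts S)" if "S \<in> D" for S
    using D(1)[OF that] inj by (auto simp: subgraph_def intro: inj_on_subset)
  have "edges G \<subseteq> Pow (verts G)" using assms(2) by (auto simp: simple_graph_def)
  \<comment> \<open>Injectivity on edges makes the image of an intersection the intersection of the
    images, so disjointness survives.\<close>
  then have inj_edges: "inj_on (image f) (edges G)"
    using inj_on_image_Pow[OF inj] by (rule inj_on_subset[rotated])
  have "is_decomposition H (image_graph f G) (image_graph f ` D)"
    unfolding is_decomposition_def
  proof (intro conjI ballI impI)
    fix S assume "S \<in> image_graph f ` D"
    then obtain S' where S': "S' \<in> D" "S = image_graph f S'" by auto
    then have sub: "simple_graph S'" "verts S' \<subseteq> verts G" "edges S' \<subseteq> edges G"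
      using D(1) by (auto simp: subgraph_def)
    then show "subgraph S (image_graph f G)"
      using S' injS[of S'] simple_graph_image_graph[of S' f] by (auto simp: subgraph_def)
    show "isomorphic S H"
      using S' sub D(2) injS[of S'] isomorphic_image_graph[of S' H f] by auto
  next
    fix S T assume "S \<in> image_graph f ` D" "T \<in> image_graph f ` D" "S \<noteq> T"
    then obtain S' T' where ST: "S' \<in> D" "S = image_graph f S'" "T' \<in> D" "T = image_graph f T'" "S' \<noteq> T'"
      by auto
    then have "edges S' \<subseteq> edges G" "edges T' \<subseteq> edges G" using D(4) by auto
    then show "edges S \<inter> edges T = {}"
      using ST D(3)[of S' T'] inj_on_image_Int[OF inj_edges, of "edges S'" "edges T'"] by auto
  next
    show "(\<Union>S\<in>image_graph f ` D. edges S) = edges (image_graph f G)"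
      using D(4) by (auto simp: image_UN[symmetric])
  qed
  then show ?thesis by (auto simp: has_decomposition_def)
qed

text \<open>The gluing principle, applied both to the layers of a product and to the translates of
  sunlets.\<close>

lemma has_decomposition_UN:
  assumes dec: "\<And>i. i \<in> I \<Longrightarrow> has_decomposition H (G i)"
    and verts: "\<And>i. i \<in> I \<Longrightarrow> verts (G i) \<subseteq> verts K"
    and disj: "\<And>i j. i \<in> I \<Longrightarrow> j \<in> I \<Longrightarrow> i \<noteq> j \<Longrightarrow> edges (G i) \<inter> edges (G j) = {}"
    and edges: "(\<Union>i\<in>I. edges (G i)) = edges K"
  shows "has_decomposition H K"
proof -
  have "\<forall>i\<in>I. \<exists>D. is_decomposition H (G i) D"
    using dec by (simp add: has_decomposition_def)
  then obtain D where D: "\<And>i. i \<in> I \<Longrightarrow> is_decomposition H (G i) (D i)"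
    by metis
  have E: "(\<Union>S\<in>D i. edges S) = edges (G i)" if "i \<in> I" for i
    using D[OF that] by (simp add: is_decomposition_def)
  have "is_decomposition H K (\<Union>i\<in>I. D i)"
    unfolding is_decomposition_def
  proof (intro conjI ballI impI)
    fix S assume "S \<in> (\<Union>i\<in>I. D i)"
    then obtain i where i: "i \<in> I" "S \<in> D i" by auto
    then have "subgraph S (G i)" using D by (auto simp: is_decomposition_def)
    then show "subgraph S K" using i verts edges unfolding subgraph_def by blast
    show "isomorphic S H" using i D by (auto simp: is_decomposition_def)
  next
    fix S T assume "S \<in> (\<Union>i\<in>I. D i)" "T \<in> (\<Union>i\<in>I. D i)" and ne: "S \<noteq> T"
    then obtain i j where ij: "i \<in> I" "S \<in> D i" "j \<in> I" "T \<in> D j" by auto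
    show "edges S \<inter> edges T = {}"
    proof (cases "i = j")
      case True
      then show ?thesis using D[OF ij(1)] ij ne unfolding is_decomposition_def by blast
    next
      case False
      then show ?thesis using disj[OF ij(1,3)] E[OF ij(1)] E[OF ij(3)] ij by blast
    qed
  next
    show "(\<Union>S\<in>\<Union>i\<in>I. D i. edges S) = edges K"
      using E edges by auto
  qed
  then show ?thesis by (auto simp: has_decomposition_def)
qed

lemma flip_append:
  "flip i (x @ y) = (if i < length x then flip i x @ y else x @ flip (i - length x) y)"
  by (simp add: flip_def list_update_append nth_append)

text \<open>Split a vertex after \<open>m\<close> bits: a direction below \<open>m\<close> stays in
  a copy of \<open>Q_m\<close> with fixed suffix, any other in a copy of \<open>Q_n\<close> with
  fixed prefix.\<close>

lemma edges_hypercube_add: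
  "edges (hypercube (m + n)) =
     (\<Union>y\<in>{y. length y = n}. edges (image_graph (\<lambda>x. x @ y) (hypercube m))) \<union>
     (\<Union>x\<in>{x. length x = m}. edges (image_graph (\<lambda>y. x @ y) (hypercube n)))" (is "_ = ?A \<union> ?B")
proof (intro equalityI subsetI)
  fix e assume "e \<in> edges (hypercube (m + n))"
  then obtain z i where z: "e = {z, flip i z}" "length z = m + n" "i < m + n"
    by (auto simp: edges_hypercube)
  define x y where "x = take m z" and "y = drop m z"
  have xy: "z = x @ y" "length x = m" "length y = n" using z by (auto simp: x_def y_def)
  show "e \<in> ?A \<union> ?B"
  proof (cases "i < m")
    case True
    then have "e = (\<lambda>x. x @ y) ` {x, flip i x}" using z xy by (auto simp: flip_append)
    moreover have "{x, flip i x} \<in> edges (hypercube m)" using xy True by (auto simp: edges_hypercube)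
    ultimately have "e \<in> edges (image_graph (\<lambda>x. x @ y) (hypercube m))"
      unfolding edges_image_graph by (rule image_eqI)
    then show ?thesis using xy by blast
  next
    case False
    then have "e = (\<lambda>y. x @ y) ` {y, flip (i - m) y}" using z xy by (auto simp: flip_append)
    moreover have "{y, flip (i - m) y} \<in> edges (hypercube n)"
    proof -
      have "i - m < n" using z(3) False by simp
      then show ?thesis unfolding edges_hypercube using xy(3) by blast
    qed
    ultimately have "e \<in> edges (image_graph (\<lambda>y. x @ y) (hypercube n))"
      unfolding edges_image_graph by (rule image_eqI)
    then show ?thesis using xy by blast
  qed
next
  fix e assume "e \<in> ?A \<union> ?B"
  then show "e \<in> edges (hypercube (m + n))"
  proof
    assume "e \<in> ?A"
    then obtain x y i where "e = {x @ y, flip i x @ y}" "length x = m" "length y = n" "i < m"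
      by (auto simp: edges_hypercube)
    then have "e = {x @ y, flip i (x @ y)} \<and> length (x @ y) = m + n \<and> i < m + n"
      by (simp add: flip_append)
    then show ?thesis unfolding edges_hypercube by blast
  next
    assume "e \<in> ?B"
    then obtain x y i where "e = {x @ y, x @ flip i y}" "length x = m" "length y = n" "i < n"
      by (auto simp: edges_hypercube)
    then have "e = {x @ y, flip (m + i) (x @ y)} \<and> length (x @ y) = m + n \<and> m + i < m + n"
      by (simp add: flip_append)
    then show ?thesis unfolding edges_hypercube by blast
  qed
qed

lemma has_decomposition_hypercube_add:
  assumes "has_decomposition H (hypercube m)" "has_decomposition H (hypercube n)"
  shows "has_decomposition H (hypercube (m + n))"
proof -
  let ?L = "\<lambda>y. image_graph (\<lambda>x. x @ y) (hypercube m)"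
  let ?R = "\<lambda>x. image_graph (\<lambda>y. x @ y) (hypercube n)"
  \<comment> \<open>The sum type keeps the two kinds of layers apart even when
    \<open>m = n\<close>.\<close>
  let ?I = "Inl ` {y. length y = n} \<union> Inr ` {x. length x = m} :: (bool list + bool list) set"
  have L: "\<exists>x i. e = {x @ y, flip i x @ y} \<and> length x = m \<and> i < m" if "e \<in> edges (?L y)" for e y
    using that by (auto simp: edges_hypercube)
  have R: "\<exists>y i. e = {x @ y, x @ flip i y} \<and> length y = n \<and> i < n" if "e \<in> edges (?R x)" for e x
    using that by (auto simp: edges_hypercube)
  \<comment> \<open>An edge of \<open>?R x\<close> keeps the prefix \<open>x\<close> at both ends,
    while an edge of \<open>?L y\<close> changes its prefix.\<close>
  have LR: "edges (?L y) \<inter> edges (?R x) = {}" if "length x = m" for x y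
  proof (rule ccontr)
    assume "edges (?L y) \<inter> edges (?R x) \<noteq> {}"
    then obtain e where "e \<in> edges (?L y)" "e \<in> edges (?R x)" by auto
    then obtain a i b j where "e = {a @ y, flip i a @ y}" "length a = m" "i < m"
      "e = {x @ b, x @ flip j b}"
      using L[of e y] R[of e x] by blast
    then have "a = x" "flip i a = x" using that by (auto simp: doubleton_eq_iff)
    then show False using flip_neq \<open>length a = m\<close> \<open>i < m\<close> by auto
  qed
  have LL: "edges (?L y) \<inter> edges (?L z) = {}" if "length y = n" "length z = n" "y \<noteq> z" for y z
  proof (rule ccontr)
    assume "edges (?L y) \<inter> edges (?L z) \<noteq> {}"
    then obtain e where "e \<in> edges (?L y)" "e \<in> edges (?L z)" by auto
    then show False using L[of e y] L[of e z] that by (auto simp: doubleton_eq_iff)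
  qed
  have RR: "edges (?R y) \<inter> edges (?R z) = {}" if "length y = m" "length z = m" "y \<noteq> z" for y z
  proof (rule ccontr)
    assume "edges (?R y) \<inter> edges (?R z) \<noteq> {}"
    then obtain e where "e \<in> edges (?R y)" "e \<in> edges (?R z)" by auto
    then show False using R[of e y] R[of e z] that by (auto simp: doubleton_eq_iff)
  qed
  show ?thesis
  proof (rule has_decomposition_UN[where I = ?I and G = "case_sum ?L ?R"])
    fix i assume i: "i \<in> ?I"
    then show "has_decomposition H (case_sum ?L ?R i)"
      using assms by (auto intro!: has_decomposition_image_graph simple_graph_hypercube simp: inj_on_def)
    show "verts (case_sum ?L ?R i) \<subseteq> verts (hypercube (m + n))"
      using i by auto
  next
    fix i j assume "i \<in> ?I" "j \<in> ?I" "i \<noteq> j"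
    then show "edges (case_sum ?L ?R i) \<inter> edges (case_sum ?L ?R j) = {}"
      by (elim UnE imageE; hypsubst; simp only: sum.case mem_Collect_eq)
        (use LL RR LR Int_commute in metis)+
  next
    show "(\<Union>i\<in>?I. edges (case_sum ?L ?R i)) = edges (hypercube (m + n))"
      unfolding edges_hypercube_add by simp
  qed
qed

subsection \<open>Translates of sunlets by a linear code\<close>

text \<open>Addition of vectors over the two-element field. Truncation to the shorter list is why
  equal lengths are assumed below.\<close>

definition vxor :: "bool list \<Rightarrow> bool list \<Rightarrow> bool list" where
  "vxor x y = map2 (\<noteq>) x y"

lemma length_vxor [simp]: "length (vxor x y) = min (length x) (length y)"
  by (simp add: vxor_def)

lemma nth_vxor [simp]: "i < length x \<Longrightarrow> i < length y \<Longrightarrow> vxor x y ! i \<longleftrightarrow> x ! i \<noteq> y ! i"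
  by (simp add: vxor_def)

text \<open>A flip adds a unit vector, so translations map edges to edges of the same
  direction.\<close>

lemma vxor_flip:
  assumes "length x = length t"
  shows "vxor t (flip i x) = flip i (vxor t x)"
  using assms by (intro nth_equalityI) (auto simp: nth_flip)

lemma vxor_cancel:
  assumes "length x = length y"
  shows "vxor (vxor x y) y = x"
  using assms by (intro nth_equalityI) auto

lemma vxor_commute: "vxor x y = vxor y x"
  by (rule nth_equalityI) auto

lemma vxor_right_inject:
  assumes "length x = length y" "length z = length y"
  shows "vxor x y = vxor z y \<longleftrightarrow> x = z"
  using assms by (metis vxor_cancel)

text \<open>A parity check matrix is given by the supports of its rows.\<close>

definition parity :: "bool list \<Rightarrow> nat list \<Rightarrow> bool" where
  "parity x r = foldr (\<lambda>i. (\<noteq>) (x ! i)) r False"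

text \<open>The matrix-vector product over the two-element field; the code is its kernel, and
  syndromes index the cosets.\<close>

definition syndrome :: "nat list list \<Rightarrow> bool list \<Rightarrow> bool list" where
  "syndrome H x = map (parity x) H"

lemma length_syndrome [simp]: "length (syndrome H x) = length H"
  by (simp add: syndrome_def)

lemma parity_vxor:
  assumes "length x = n" "length y = n" "\<forall>i\<in>set r. i < n"
  shows "parity (vxor x y) r \<longleftrightarrow> parity x r \<noteq> parity y r"
  using assms(3) by (induction r) (auto simp: parity_def assms(1,2))

lemma syndrome_vxor:
  assumes "length x = n" "length y = n" "\<forall>r\<in>set H. \<forall>i\<in>set r. i < n"
  shows "syndrome H (vxor x y) = vxor (syndrome H x) (syndrome H y)"
proof (rule nth_equalityI)
  fix j assume "j < length (syndrome H (vxor x y))"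
  then show "syndrome H (vxor x y) ! j = vxor (syndrome H x) (syndrome H y) ! j"
    using parity_vxor[OF assms(1,2) bspec[OF assms(3) nth_mem], of j] by (simp add: syndrome_def)
qed simp

text \<open>
  The triple \<open>(cs, ds, ps)\<close> stands for the sunlet whose cycle visits the vertices \<open>cs\<close>, leaving
  \<open>cs ! i\<close> in direction \<open>ds ! i\<close>, and whose pendant edge at \<open>cs ! i\<close> has direction \<open>ps ! i\<close>.
\<close>

type_synonym sun = "bool list list \<times> nat list \<times> nat list"

fun walk :: "bool list \<Rightarrow> nat list \<Rightarrow> bool list list" where
  "walk x [] = []"
| "walk x (d # ds) = x # walk (flip d x) ds"

text \<open>The start vertex is given by its support \<open>s\<close>. A walk lists only the
  vertices that a step leaves; that the last step closes the cycle is checked by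
  \<open>is_sun\<close>.\<close>

definition walk_sun :: "nat \<Rightarrow> nat list \<Rightarrow> nat list \<Rightarrow> nat list \<Rightarrow> sun" where
  "walk_sun n s ds ps = (walk (map (\<lambda>i. i \<in> set s) [0..<n]) ds, ds, ps)"

text \<open>The \<open>rotate1\<close> equation expresses all cycle steps at once, including the
  closing one.\<close>

fun is_sun :: "nat \<Rightarrow> nat \<Rightarrow> sun \<Rightarrow> bool" where
  "is_sun k n (cs, ds, ps) \<longleftrightarrow>
     length cs = k \<and> length ds = k \<and> length ps = k \<and>
     list_all (\<lambda>c. length c = n) cs \<and> list_all (\<lambda>i. i < n) ds \<and> list_all (\<lambda>i. i < n) ps \<and>
     rotate1 cs = map2 flip ds cs \<and> distinct (cs @ map2 flip ps cs)"

text \<open>Each edge occurs here with one end point; \<open>arcs\<close> adds the other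
  orientation.\<close>

fun slots :: "sun \<Rightarrow> (bool list \<times> nat) list" where
  "slots (cs, ds, ps) = zip cs ds @ zip cs ps"

fun place :: "sun \<Rightarrow> bool list \<Rightarrow> nat \<times> bool \<Rightarrow> bool list" where
  "place (cs, ds, ps) t (j, b) = vxor t (if b then flip (ps ! j) (cs ! j) else cs ! j)"

lemma slots_bounds:
  assumes "is_sun k n S" "(x, i) \<in> set (slots S)"
  shows "length x = n" "i < n"
proof -
  obtain cs ds ps where S: "S = (cs, ds, ps)" by (cases S)
  have "x \<in> set cs" "i \<in> set ds \<union> set ps"
    using assms(2) by (auto simp: S dest: set_zip_leftD set_zip_rightD)
  then show "length x = n" "i < n"
    using assms(1) by (auto simp: S list_all_iff)
qed

text \<open>Translation is injective and commutes with flips, so each translate is a copy of the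
  sunlet whose edges can be read off from \<open>slots\<close>.\<close>

lemma place_sunlet:
  assumes S: "is_sun k n S" and t: "length t = n"
  shows "inj_on (place S t) (verts (sunlet k))"
    and "place S t ` verts (sunlet k) \<subseteq> {x. length x = n}"
    and "edges (image_graph (place S t) (sunlet k)) =
      (\<lambda>(x, i). {vxor t x, flip i (vxor t x)}) ` set (slots S)"
proof -
  obtain cs ds ps where Seq: "S = (cs, ds, ps)" by (cases S)
  have len: "length cs = k" "length ds = k" "length ps = k"
    and lc: "\<And>j. j < k \<Longrightarrow> length (cs ! j) = n"
    and rot: "rotate1 cs = map2 flip ds cs" and dist: "distinct (cs @ map2 flip ps cs)"
    using S by (auto simp: Seq list_all_length)
  \<comment> \<open>The \<open>rotate1\<close> equation read at position \<open>j\<close>; the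
    wrap-around agrees with that of \<open>sunlet\<close>.\<close>
  have next_eq: "cs ! (Suc j mod k) = flip (ds ! j) (cs ! j)" if "j < k" for j
    using that len nth_rotate1[of j cs] by (simp add: rot)
  have ps: "map2 flip ps cs ! j = flip (ps ! j) (cs ! j)" if "j < k" for j
    using that len by simp
  have cc: "cs ! i = cs ! j \<longleftrightarrow> i = j" if "i < k" "j < k" for i j
    using that len dist by (simp add: nth_eq_iff_index_eq)
  have pp: "flip (ps ! i) (cs ! i) = flip (ps ! j) (cs ! j) \<longleftrightarrow> i = j" if "i < k" "j < k" for i j
    using that len dist nth_eq_iff_index_eq[of "map2 flip ps cs" i j] by simp
  have cp: "cs ! i \<noteq> flip (ps ! j) (cs ! j)" if "i < k" "j < k" for i j
  proof -
    have "cs ! i \<in> set cs" "map2 flip ps cs ! j \<in> set (map2 flip ps cs)"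
      using that len by (intro nth_mem; simp)+
    then show ?thesis using dist ps[OF that(2)] unfolding distinct_append by (metis disjoint_iff)
  qed
  have xor_eq: "vxor t x = vxor t y \<longleftrightarrow> x = y" if "length x = n" "length y = n" for x y
    using that t by (metis vxor_commute vxor_right_inject)
  show "inj_on (place S t) (verts (sunlet k))"
    by (auto simp: inj_on_def sunlet_def Seq xor_eq lc cc pp cp cp[symmetric] split: if_splits)
  show "place S t ` verts (sunlet k) \<subseteq> {x. length x = n}"
    using t lc by (auto simp: sunlet_def Seq)
  have "edges (sunlet k) = (\<lambda>j. {(j, False), (Suc j mod k, False)}) ` {..<k}
      \<union> (\<lambda>j. {(j, False), (j, True)}) ` {..<k}"
    by (auto simp: sunlet_def)
  then have "edges (image_graph (place S t) (sunlet k)) =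
      (\<lambda>j. {vxor t (cs ! j), vxor t (cs ! (Suc j mod k))}) ` {..<k}
      \<union> (\<lambda>j. {vxor t (cs ! j), vxor t (flip (ps ! j) (cs ! j))}) ` {..<k}"
    by (simp add: Seq image_Un image_image)
  also have "\<dots> = (\<lambda>j. {vxor t (cs ! j), flip (ds ! j) (vxor t (cs ! j))}) ` {..<k}
      \<union> (\<lambda>j. {vxor t (cs ! j), flip (ps ! j) (vxor t (cs ! j))}) ` {..<k}"
    by (intro arg_cong2[of _ _ _ _ "(\<union>)"] image_cong) (auto simp: next_eq vxor_flip lc t)
  also have "\<dots> = (\<lambda>(x, i). {vxor t x, flip i (vxor t x)}) `
      ((\<lambda>j. (cs ! j, ds ! j)) ` {..<k} \<union> (\<lambda>j. (cs ! j, ps ! j)) ` {..<k})"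
    by (simp add: image_Un image_image)
  also have "(\<lambda>j. (cs ! j, ds ! j)) ` {..<k} \<union> (\<lambda>j. (cs ! j, ps ! j)) ` {..<k} = set (slots S)"
    using len by (auto simp: Seq set_zip)
  finally show "edges (image_graph (place S t) (sunlet k)) =
      (\<lambda>(x, i). {vxor t x, flip i (vxor t x)}) ` set (slots S)" .
qed

text \<open>The flag selects the end point: \<open>False\<close> for \<open>x\<close>,
  \<open>True\<close> for \<open>flip i x\<close>. Keeping \<open>x\<close> itself allows the slot
  to be recovered from an arc.\<close>

definition arcs :: "sun list \<Rightarrow> (sun \<times> bool \<times> bool list \<times> nat) list" where
  "arcs B = concat (map (\<lambda>S. concat (map (\<lambda>(x, i). [(S, False, x, i), (S, True, x, i)]) (slots S))) B)"

lemma set_arcs: "(S, b, x, i) \<in> set (arcs B) \<longleftrightarrow> S \<in> set B \<and> (x, i) \<in> set (slots S)"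
  by (cases b) (auto simp: arcs_def)

fun arc_label :: "nat list list \<Rightarrow> sun \<times> bool \<times> bool list \<times> nat \<Rightarrow> bool list \<times> nat" where
  "arc_label H (S, b, x, i) = (syndrome H (if b then flip i x else x), i)"

text \<open>There are \<open>n * 2 ^ length H\<close> possible labels, so distinct labels in this
  number exhaust them. Every condition is a finite computation.\<close>

definition base_suns :: "nat \<Rightarrow> nat \<Rightarrow> nat list list \<Rightarrow> sun list \<Rightarrow> bool" where
  "base_suns k n H B \<longleftrightarrow>
     k \<ge> 3 \<and> list_all (list_all (\<lambda>i. i < n)) H \<and> list_all (is_sun k n) B \<and>
     distinct (map (arc_label H) (arcs B)) \<and> length (arcs B) = n * 2 ^ length H"

text \<open>Injectivity of the labels makes the translates edge-disjoint; surjectivity makes them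
  cover the cube.\<close>

lemma has_decomposition_if_base_suns:
  assumes "base_suns k n H B"
  shows "has_decomposition (sunlet k) (hypercube n)"
proof -
  have k: "k \<ge> 3" and H: "\<forall>r\<in>set H. \<forall>i\<in>set r. i < n" and sun: "\<And>S. S \<in> set B \<Longrightarrow> is_sun k n S"
    and dist: "distinct (map (arc_label H) (arcs B))" and len: "length (arcs B) = n * 2 ^ length H"
    using assms unfolding base_suns_def list_all_iff by metis+
  have inj: "inj_on (arc_label H) (set (arcs B))" and dist_arcs: "distinct (arcs B)"
    using dist by (auto simp: distinct_map)
  have labels: "arc_label H ` set (arcs B) = {s. length s = length H} \<times> {..<n}"
  proof (rule card_subset_eq)
    show "finite ({s :: bool list. length s = length H} \<times> {..<n})"
      by (simp add: finite_verts_hypercube)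
    show "arc_label H ` set (arcs B) \<subseteq> {s. length s = length H} \<times> {..<n}"
    proof
      fix l assume "l \<in> arc_label H ` set (arcs B)"
      then obtain S b x i where "(S, b, x, i) \<in> set (arcs B)" "l = arc_label H (S, b, x, i)"
        by (metis imageE prod_cases4)
      moreover from this have "i < n" using slots_bounds(2)[OF sun] unfolding set_arcs by blast
      ultimately show "l \<in> {s. length s = length H} \<times> {..<n}" by simp
    qed
    show "card (arc_label H ` set (arcs B)) = card ({s :: bool list. length s = length H} \<times> {..<n})"
      using inj dist_arcs len by (simp add: card_image distinct_card card_cartesian_product card_verts_hypercube)
  qed
  \<comment> \<open>\<open>T\<close> is the code, the set of vectors with zero syndrome.\<close>
  define T where "T = {t. length t = n \<and> True \<notin> set (syndrome H t)}"
  have syn_T: "syndrome H (vxor t x) = syndrome H x" if "t \<in> T" "length x = n" for t x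
  proof (rule nth_equalityI)
    fix j assume "j < length (syndrome H (vxor t x))"
    moreover from this have "\<not> syndrome H t ! j" using that(1) by (metis (mono_tags, lifting) T_def length_syndrome mem_Collect_eq nth_mem)
    ultimately show "syndrome H (vxor t x) ! j = syndrome H x ! j"
      using that H by (simp add: T_def syndrome_vxor)
  qed simp
  have xor_T: "vxor x y \<in> T" if "length x = n" "length y = n" "syndrome H x = syndrome H y" for x y
    using that H by (auto simp: T_def syndrome_vxor in_set_conv_nth)
  let ?G = "\<lambda>(S, t). image_graph (place S t) (sunlet k)"
  have edgesG: "e \<in> edges (?G (S, t)) \<longleftrightarrow>
      (\<exists>x i. (x, i) \<in> set (slots S) \<and> e = {vxor t x, flip i (vxor t x)})"
    if "S \<in> set B" "t \<in> T" for S t e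
  proof -
    have "length t = n" using that(2) by (simp add: T_def)
    then show ?thesis
      using place_sunlet(3)[OF sun[OF that(1)], of t] by (auto simp del: edges_image_graph)
  qed
  show ?thesis
  proof (rule has_decomposition_UN[where I = "set B \<times> T" and G = ?G])
    fix p assume "p \<in> set B \<times> T"
    then obtain S t where p: "p = (S, t)" "S \<in> set B" "length t = n" by (auto simp: T_def)
    show "has_decomposition (sunlet k) (?G p)"
      using p(1) place_sunlet(1)[OF sun[OF p(2)] p(3)] k
      by (auto intro!: has_decomposition_image_graph has_decomposition_refl simple_graph_sunlet)
    show "verts (?G p) \<subseteq> verts (hypercube n)"
      using p(1) place_sunlet(2)[OF sun[OF p(2)] p(3)] by simp
  next
    fix p q assume pq: "p \<in> set B \<times> T" "q \<in> set B \<times> T" "p \<noteq> q"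
    obtain S t where p: "p = (S, t)" "S \<in> set B" "t \<in> T" using pq by auto
    obtain S' t' where q: "q = (S', t')" "S' \<in> set B" "t' \<in> T" using pq by auto
    have t: "length t = n" "length t' = n" using p q by (auto simp: T_def)
    show "edges (?G p) \<inter> edges (?G q) = {}"
    proof (rule ccontr)
      assume "edges (?G p) \<inter> edges (?G q) \<noteq> {}"
      then obtain e where e: "e \<in> edges (?G (S, t))" "e \<in> edges (?G (S', t'))"
        unfolding p(1) q(1) by blast
      obtain x i where x: "(x, i) \<in> set (slots S)" "e = {vxor t x, flip i (vxor t x)}"
        using e(1) unfolding edgesG[OF p(2,3)] by blast
      obtain x' i' where x': "(x', i') \<in> set (slots S')" "e = {vxor t' x', flip i' (vxor t' x')}"
        using e(2) unfolding edgesG[OF q(2,3)] by blast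
      have eq: "{vxor t x, flip i (vxor t x)} = {vxor t' x', flip i' (vxor t' x')}"
        using x(2) x'(2) by simp
      have bd: "length x = n" "i < n" "length x' = n" "i' < n"
        using slots_bounds[OF sun] x(1) x'(1) p(2) q(2) by blast+
      \<comment> \<open>The shared edge has one direction, and its end point \<open>vxor t x\<close>
        is one of the two end points in the other description.\<close>
      have i: "i' = i" and or: "vxor t x = vxor t' x' \<or> vxor t x = vxor t' (flip i x')"
        using eq bd t by (auto simp: edge_flip_eq_iff vxor_flip)
      have arcs: "(S, False, x, i) \<in> set (arcs B)" "(S', b, x', i) \<in> set (arcs B)" for b
        using p(2) q(2) x(1) x'(1) i by (simp_all add: set_arcs)
      from or show False
      proof
        \<comment> \<open>Same orientation: equal labels force the same sunlet and slot, hence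
          \<open>t = t'\<close>, contradicting \<open>p \<noteq> q\<close>.\<close>
        assume e: "vxor t x = vxor t' x'"
        then have "syndrome H x = syndrome H x'" using syn_T p(3) q(3) bd by metis
        then have "S = S'" "x = x'" using inj_onD[OF inj _ arcs(1) arcs(2)[of False]] by auto
        then show False using e pq(3) p(1) q(1) t bd by (simp add: vxor_right_inject)
      next
        \<comment> \<open>Opposite orientation: two arcs with different flags would share a
          label.\<close>
        assume "vxor t x = vxor t' (flip i x')"
        then have "syndrome H x = syndrome H (flip i x')" using syn_T p(3) q(3) bd by (metis length_flip)
        then show False using inj_onD[OF inj _ arcs(1) arcs(2)[of True]] by auto
      qed
    qed
  next
    show "(\<Union>p\<in>set B \<times> T. edges (?G p)) = edges (hypercube n)"
    proof (intro equalityI subsetI)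
      fix e assume "e \<in> (\<Union>p\<in>set B \<times> T. edges (?G p))"
      then obtain S t where "S \<in> set B" "t \<in> T" "e \<in> edges (?G (S, t))" by blast
      moreover from this obtain x i where "(x, i) \<in> set (slots S)" "e = {vxor t x, flip i (vxor t x)}"
        using edgesG by blast
      moreover from calculation have "length x = n" "length t = n" "i < n"
        using slots_bounds[OF sun] unfolding T_def by blast+
      then have "length (vxor t x) = n" "i < n" by simp_all
      ultimately show "e \<in> edges (hypercube n)" unfolding edges_hypercube by blast
    next
      fix e assume "e \<in> edges (hypercube n)"
      then obtain x i where x: "e = {x, flip i x}" "length x = n" "i < n"
        by (auto simp: edges_hypercube)
      then have "(syndrome H x, i) \<in> arc_label H ` set (arcs B)"
        by (simp add: labels)
      then obtain S b z where z: "(S, b, z, i) \<in> set (arcs B)"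
        "syndrome H x = syndrome H (if b then flip i z else z)"
        by auto
      then have S: "S \<in> set B" "(z, i) \<in> set (slots S)" by (auto simp: set_arcs)
      then have lz: "length z = n" using slots_bounds[OF sun] by blast
      \<comment> \<open>\<open>y\<close> is the end point of the base edge that lies in the coset of
        \<open>x\<close>; the codeword \<open>t\<close> moves it to \<open>x\<close>.\<close>
      define y where "y = (if b then flip i z else z)"
      define t where "t = vxor x y"
      have t: "t \<in> T" "vxor t y = x"
        using x lz z xor_T vxor_cancel by (auto simp: t_def y_def)
      then have "length t = n" by (simp add: T_def)
      then have "e = {vxor t z, flip i (vxor t z)}"
        using x t lz by (auto simp: y_def vxor_flip split: if_splits)
      then have "e \<in> edges (?G (S, t))" using S t edgesG by blast
      then show "e \<in> (\<Union>p\<in>set B \<times> T. edges (?G p))" using S t by blast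
    qed
  qed
qed

subsection \<open>Dimensions 4, 6, 7 and 9\<close>

text \<open>The following sunlets were found by a randomised computer search.\<close>

lemma has_decomposition_hypercube_4: "has_decomposition (sunlet 8) (hypercube 4)"
  by (rule has_decomposition_if_base_suns
      \<comment> \<open>The identity matrix gives the trivial code: the two sunlets themselves
        decompose \<open>Q_4\<close>.\<close>
      [where H = "[[0], [1], [2], [3]]" and
       B = "[walk_sun 4 [2] [2, 0, 3, 1, 2, 0, 3, 1] [0, 3, 1, 2, 0, 3, 1, 2],
       walk_sun 4 [2, 3] [0, 3, 1, 2, 0, 3, 1, 2] [3, 1, 2, 0, 3, 1, 2, 0]]"])
    code_simp

text \<open>The code has 4 words, so 3 sunlets yield 12 copies for the 192 edges.\<close>

lemma has_decomposition_hypercube_6: "has_decomposition (sunlet 8) (hypercube 6)"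
  by (rule has_decomposition_if_base_suns
      [where H = "[[0, 4], [1, 4], [2, 5], [3, 5]]" and
       B = "[walk_sun 6 [1, 3] [2, 4, 0, 3, 4, 2, 0, 3] [5, 3, 2, 1, 0, 1, 3, 5],
       walk_sun 6 [0, 3] [3, 4, 2, 0, 3, 4, 2, 0] [5, 1, 1, 4, 5, 0, 5, 3],
       walk_sun 6 [] [0, 5, 1, 2, 0, 1, 5, 2] [4, 2, 3, 5, 1, 4, 4, 1]]"])
    code_simp

text \<open>Again 4 codewords; 7 sunlets yield 28 copies for the 448 edges.\<close>

lemma has_decomposition_hypercube_7: "has_decomposition (sunlet 8) (hypercube 7)"
  by (rule has_decomposition_if_base_suns
      [where H = "[[0, 5, 6], [1, 5], [2, 5], [3, 6], [4, 6]]" and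
       B = "[walk_sun 7 [0, 1, 2, 3] [4, 3, 1, 2, 4, 3, 1, 2] [5, 6, 4, 4, 0, 1, 4, 5],
       walk_sun 7 [1, 2, 3, 4] [3, 0, 6, 2, 0, 6, 3, 2] [0, 5, 5, 3, 5, 3, 1, 4],
       walk_sun 7 [0, 1, 3, 4] [6, 5, 3, 4, 3, 6, 4, 5] [3, 4, 1, 2, 5, 0, 3, 0],
       walk_sun 7 [0, 3, 4] [1, 0, 1, 4, 0, 5, 4, 5] [3, 4, 6, 6, 2, 6, 1, 6],
       walk_sun 7 [1, 2] [1, 6, 1, 5, 2, 6, 2, 5] [4, 5, 2, 2, 0, 1, 0, 0],
       walk_sun 7 [4] [2, 1, 2, 0, 4, 0, 1, 4] [3, 3, 6, 5, 1, 2, 2, 6],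
       walk_sun 7 [0, 1, 2] [5, 3, 1, 6, 5, 6, 1, 3] [0, 2, 6, 3, 2, 4, 0, 0]]"])
    code_simp

text \<open>Here 16 codewords and 9 sunlets yield 144 copies for the 2304 edges.\<close>

lemma has_decomposition_hypercube_9: "has_decomposition (sunlet 8) (hypercube 9)"
  by (rule has_decomposition_if_base_suns
      [where H = "[[0, 5, 6, 8], [1, 5, 7, 8], [2, 6, 7, 8], [3, 7, 8], [4, 8]]" and
       B = "[walk_sun 9 [1, 2, 3] [0, 1, 4, 2, 0, 2, 4, 1] [6, 4, 8, 8, 7, 6, 5, 5],
       walk_sun 9 [0, 2, 4] [0, 6, 0, 3, 5, 3, 6, 5] [2, 7, 8, 2, 7, 1, 0, 2],
       walk_sun 9 [0, 1, 3] [5, 1, 8, 1, 0, 8, 5, 0] [2, 4, 2, 4, 5, 1, 7, 3],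
       walk_sun 9 [1, 2] [7, 3, 0, 6, 7, 6, 3, 0] [1, 2, 2, 4, 5, 4, 8, 8],
       walk_sun 9 [1, 4] [1, 7, 1, 0, 3, 7, 0, 3] [5, 4, 3, 6, 5, 6, 6, 6],
       walk_sun 9 [0, 1, 2, 3, 4] [7, 1, 4, 1, 2, 7, 4, 2] [1, 3, 5, 3, 7, 6, 8, 8],
       walk_sun 9 [1] [2, 8, 4, 2, 7, 8, 7, 4] [1, 4, 5, 6, 3, 5, 3, 6],
       walk_sun 9 [1, 2, 3] [5, 6, 0, 3, 5, 0, 6, 3] [7, 0, 8, 1, 8, 6, 2, 5],
       walk_sun 9 [1, 2, 3, 4] [0, 3, 2, 8, 3, 0, 8, 2] [4, 8, 4, 7, 7, 4, 1, 1]]"])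
    code_simp

lemma has_decomposition_hypercube:
  "n = 4 \<or> n \<ge> 6 \<Longrightarrow> has_decomposition (sunlet 8) (hypercube n)"
proof (induction n rule: less_induct)
  case (less n)
  show ?case
  \<comment> \<open>These are exactly the admissible \<open>n\<close> for which \<open>n - 4\<close>
    is not admissible; all others split off a factor \<open>Q_4\<close>.\<close>
  proof (cases "n \<in> {4, 6, 7, 9}")
    case True
    then show ?thesis
      using has_decomposition_hypercube_4 has_decomposition_hypercube_6
        has_decomposition_hypercube_7 has_decomposition_hypercube_9 by auto
  next
    case False
    then have "n - 4 < n" "n - 4 = 4 \<or> n - 4 \<ge> 6" "4 + (n - 4) = n" using less.prems by auto
    then show ?thesis
      using less.IH[of "n - 4"] has_decomposition_hypercube_add[OF has_decomposition_hypercube_4, of "n - 4"]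
      by simp
  qed
qed

theorem theorem11:
  fixes n :: nat
  assumes "n \<ge> 1"
  shows "has_decomposition (sunlet 8) (hypercube n) \<longleftrightarrow> n = 4 \<or> n \<ge> 6"
  using has_decomposition_hypercube[of n] sunlet_8_decomposition_imp[OF assms] by (rule iffI[rotated])

end
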